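(* Let $\Sigma$ be a finite alphabet, $A \subseteq \Sigma$ and $r \geq 0$. If $F$ is a surjective cellular automaton on $\Sigma^{\mathbb{Z}}$ of radius at most $r$, then $C^A_A(F,r,1) \leq C^A_A(\mathrm{id},r,1)$, and hence $\bar{C}^A_A(F) \leq \bar{C}^A_A(\mathrm{id}) = |A|$, where $\mathrm{id}$ is the identity cellular automaton.
   Context: A cellular automaton (CA) of radius $r \geq 0$ is a function $F : \Sigma^{\mathbb{Z}} \to \Sigma^{\mathbb{Z}}$ defined by a local rule $f : \Sigma^{r+1} \to \Sigma$ via $F(x)_i = f(x_{[i,i+r]})$, where $x_{[i,i+r]} = x_i \cdots x_{i+r}$. A CA of radius at most $r$ also has a (unique) radius-$r$ local rule (ignoring extra coordinates on the right). The identity CA $\mathrm{id}$ has radius $0$; its radius-$r$ local rule is $w_0 w_1\cdots w_r \mapsto w_0$. For a word $w$ and $A \subseteq \Sigma$, $|w|_A$ is the number of positions of $w$ carrying a symbol of $A$. For a CA $F$ of radius at most $r$ with radius-$r$ local rule $f : \Sigma^{r+1} \to \Sigma$, sets $A, B \subseteq \Sigma$ and $0 \le k \le r+1$, let $N^A_B(F,r,k) = |\{ w \in \Sigma^{r+1} \mid f(w) \in B, |w|_A = k \}|$. The $(A,B,r)$-correlation of order $m \geq 0$ of $F$ is $C^A_B(F,r,m) = \sum_{k=0}^{r+1} k^m N^A_B(F,r,k) = \sum_{w \in f^{-1}(B)} |w|_A^m$ (with $0^0 = 1$). Whenever $s$ is at least the radius of $F$, these satisfy the recursion $C^A_B(F,s+1,m)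 = |\Sigma| \cdot C^A_B(F,s,m) + |A| \sum_{i=0}^{m-1} \binom{m}{i} C^A_B(F,s,i)$. The definition of $C^A_B(F,s,m)$ is extended to all $s, m \geq 0$, including $s$ smaller than the radius of $F$, by requiring this recursion to hold for all $s \ge 0$ and $m \ge 0$ (i.e. solving it downward in $s$). The normalized $(A,B)$-correlation of order $m$ is $\bar{C}^A_B(F,m) = C^A_B(F,0,m)$, and $\bar{C}^A_B(F) = \bar{C}^A_B(F,1)$. *)

theory Defs
  imports Complex_Main "HOL-Library.Cardinality"
begin

text \<open>The alphabet \<open>\<Sigma>\<close> is a type of class \<^class>\<open>finite\<close> (types being nonempty, so is \<open>\<Sigma>\<close>),
  configurations in \<open>\<Sigma>\<^sup>\<int>\<close> are functions \<^typ>\<open>int \<Rightarrow> 'a\<close>, and words are lists.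
  Local rules are functions on all lists, of which only the values on words of length \<open>r + 1\<close>
  are relevant.\<close>

definition is_local_rule :: "nat \<Rightarrow> ('a list \<Rightarrow> 'a) \<Rightarrow> ((int \<Rightarrow> 'a) \<Rightarrow> (int \<Rightarrow> 'a)) \<Rightarrow> bool" where
  "is_local_rule r f F \<longleftrightarrow> (\<forall>x i. F x i = f (map x [i..i + int r]))"

definition ca_radius_at_most :: "nat \<Rightarrow> ((int \<Rightarrow> 'a) \<Rightarrow> (int \<Rightarrow> 'a)) \<Rightarrow> bool" where
  "ca_radius_at_most r F \<longleftrightarrow> (\<exists>s\<le>r. \<exists>f. is_local_rule s f F)"

definition ca_radius :: "((int \<Rightarrow> 'a) \<Rightarrow> (int \<Rightarrow> 'a)) \<Rightarrow> nat" where
  "ca_radius F = (LEAST r. \<exists>f. is_local_rule r f F)"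

text \<open>Only meaningful if \<open>F\<close> has radius at most \<open>r\<close>; the choice is then irrelevant on words of
  length \<open>r + 1\<close>, see \<open>local_rule_eqI\<close>.\<close>

definition local_rule :: "nat \<Rightarrow> ((int \<Rightarrow> 'a) \<Rightarrow> (int \<Rightarrow> 'a)) \<Rightarrow> 'a list \<Rightarrow> 'a" where
  "local_rule r F = (SOME f. is_local_rule r f F)"

definition occ :: "'a set \<Rightarrow> 'a list \<Rightarrow> nat" where
  "occ A w = length (filter (\<lambda>a. a \<in> A) w)"

definition corr_count ::
    "'a set \<Rightarrow> 'a set \<Rightarrow> ((int \<Rightarrow> 'a) \<Rightarrow> (int \<Rightarrow> 'a)) \<Rightarrow> nat \<Rightarrow> nat \<Rightarrow> nat" where
  "corr_count A B F r k =
     card {w. length w = r + 1 \<and> local_rule r F w \<in> B \<and> occ A w = k}"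

definition corr ::
    "'a set \<Rightarrow> 'a set \<Rightarrow> ((int \<Rightarrow> 'a) \<Rightarrow> (int \<Rightarrow> 'a)) \<Rightarrow> nat \<Rightarrow> nat \<Rightarrow> nat" where
  "corr A B F r m = (\<Sum>k = 0..r + 1. k ^ m * corr_count A B F r k)"

text \<open>The extension of \<^const>\<open>corr\<close> below the radius of \<open>F\<close>, by solving the recursion of lemma
  \<open>corr_Suc\<close> for its term of index \<open>(s, m)\<close>. The extended function satisfies the recursion
  everywhere (\<open>corr_ext_Suc\<close>) and is the only such function (\<open>corr_ext_unique\<close>).\<close>

function corr_ext ::
    "'a::finite set \<Rightarrow> 'a set \<Rightarrow> ((int \<Rightarrow> 'a) \<Rightarrow> (int \<Rightarrow> 'a)) \<Rightarrow> nat \<Rightarrow> nat \<Rightarrow> real" where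
  "corr_ext A B F s m =
     (if ca_radius F \<le> s then real (corr A B F s m)
      else (corr_ext A B F (s + 1) m
              - real (card A) * (\<Sum>i<m. real (m choose i) * corr_ext A B F s i))
           / real CARD('a))"
  by pat_completeness auto
termination
  by (relation "measures [\<lambda>(A, B, F, s, m). ca_radius F - s, \<lambda>(A, B, F, s, m). m]") auto

declare corr_ext.simps [simp del]

definition norm_corr ::
    "'a::finite set \<Rightarrow> 'a set \<Rightarrow> ((int \<Rightarrow> 'a) \<Rightarrow> (int \<Rightarrow> 'a)) \<Rightarrow> nat \<Rightarrow> real" where
  "norm_corr A B F m = corr_ext A B F 0 m"


lemma is_local_rule_unique:
  assumes "is_local_rule r f F" "is_local_rule r g F" "length w = r + 1"
  shows "f w = g w"
proof -
  define x where "x = (\<lambda>i::int. w ! nat i)"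
  have "map x [0..0 + int r] = w"
    by (rule nth_equalityI) (use assms(3) in \<open>auto simp: x_def\<close>)
  then show ?thesis
    using assms(1,2) unfolding is_local_rule_def by metis
qed

lemma is_local_rule_Suc:
  assumes "is_local_rule r f F"
  shows "is_local_rule (Suc r) (\<lambda>w. f (butlast w)) F"
proof -
  have "butlast (map x [i..i + int (Suc r)]) = map x [i..i + int r]" for x :: "int \<Rightarrow> 'a" and i
    using upto_rec2[of i "i + int (Suc r)"] by simp
  then show ?thesis
    using assms unfolding is_local_rule_def by simp
qed

lemma is_local_rule_mono:
  assumes "is_local_rule r f F" "r \<le> s"
  shows "\<exists>g. is_local_rule s g F"
  using assms(2,1)
proof (induction s rule: dec_induct)
  case (step n)
  then show ?case using is_local_rule_Suc by blast
qed blast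

lemma ca_radius_at_most_iff: "ca_radius_at_most r F \<longleftrightarrow> (\<exists>f. is_local_rule r f F)"
  unfolding ca_radius_at_most_def using is_local_rule_mono by blast

lemma local_rule_eqI:
  assumes "is_local_rule r f F" "length w = r + 1"
  shows "local_rule r F w = f w"
proof -
  have "is_local_rule r (local_rule r F) F"
    unfolding local_rule_def using assms(1) by (rule someI[where P = "\<lambda>f. is_local_rule r f F"])
  then show ?thesis
    using is_local_rule_unique assms by blast
qed

lemma is_local_rule_local_rule:
  assumes "ca_radius_at_most r F"
  shows "is_local_rule r (local_rule r F) F"
  using assms unfolding ca_radius_at_most_iff local_rule_def by (rule someI_ex)

lemma ca_radius_le_iff:
  assumes "ca_radius_at_most r F"
  shows "ca_radius F \<le> s \<longleftrightarrow> ca_radius_at_most s F"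
proof
  obtain f where f: "is_local_rule r f F"
    using assms ca_radius_at_most_iff by blast
  have "\<exists>f. is_local_rule (ca_radius F) f F"
    unfolding ca_radius_def by (rule LeastI) (use f in blast)
  then show "ca_radius_at_most s F" if "ca_radius F \<le> s"
    unfolding ca_radius_at_most_def using that by blast
next
  assume "ca_radius_at_most s F"
  then show "ca_radius F \<le> s"
    unfolding ca_radius_at_most_iff ca_radius_def by (rule Least_le)
qed

lemma is_local_rule_id: "is_local_rule r hd id"
  unfolding is_local_rule_def by (simp add: upto_rec1)

lemma finite_words: "finite {w :: 'a::finite list. length w = n \<and> P w}"
  by (rule finite_subset[OF _ finite_lists_length_eq[of UNIV n]]) auto

lemma corr_eq_sum:
  fixes A B :: "'a::finite set"
  shows "corr A B F r m =
    (\<Sum>w\<in>{w. length w = r + 1 \<and> local_rule r F w \<in> B}. occ A w ^ m)"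
proof -
  let ?W = "{w. length w = r + 1 \<and> local_rule r F w \<in> B}"
  have occ_le: "occ A w \<le> r + 1" if "w \<in> ?W" for w
    using that length_filter_le[of "\<lambda>a. a \<in> A" w] by (simp add: occ_def)
  have "(\<Sum>w\<in>?W. occ A w ^ m) = (\<Sum>k\<in>{0..r + 1}. \<Sum>w\<in>{w \<in> ?W. occ A w = k}. occ A w ^ m)"
    using occ_le by (intro sum.group[symmetric]) (auto simp: finite_words)
  also have "\<dots> = (\<Sum>k = 0..r + 1. k ^ m * corr_count A B F r k)"
    by (intro sum.cong) (simp_all add: corr_count_def conj_assoc mult.commute)
  finally show ?thesis
    by (simp add: corr_def)
qed

lemma corr_Suc:
  fixes A B :: "'a::finite set"
  assumes "ca_radius_at_most s F"
  shows "corr A B F (s + 1) m =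
    CARD('a) * corr A B F s m + card A * (\<Sum>i<m. (m choose i) * corr A B F s i)"
proof -
  let ?W = "\<lambda>s. {w. length w = s + 1 \<and> local_rule s F w \<in> B}"
  note rule = is_local_rule_local_rule[OF assms]
  have lr: "local_rule (Suc s) F (w @ [a]) = local_rule s F w" if "length w = s + 1" for w a
    using local_rule_eqI[OF is_local_rule_Suc[OF rule], of "w @ [a]"] that by simp
  have bij: "bij_betw (\<lambda>(w, a). w @ [a]) (?W s \<times> UNIV) (?W (s + 1))"
  proof (rule bij_betw_imageI)
    show "inj_on (\<lambda>(w, a). w @ [a]) (?W s \<times> UNIV)"
      by (auto simp: inj_on_def)
    show "(\<lambda>(w, a). w @ [a]) ` (?W s \<times> UNIV) = ?W (s + 1)"
    proof (intro equalityI subsetI)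
      fix v assume v: "v \<in> ?W (s + 1)"
      then obtain w a where wa: "v = w @ [a]"
        by (cases v rule: rev_cases) auto
      then have "w \<in> ?W s"
        using v lr[of w a] by simp
      then show "v \<in> (\<lambda>(w, a). w @ [a]) ` (?W s \<times> UNIV)"
        using wa by force
    qed (auto simp: lr)
  qed
  have step: "(\<Sum>a\<in>UNIV. occ A (w @ [a]) ^ m) =
      CARD('a) * occ A w ^ m + card A * (\<Sum>i<m. (m choose i) * occ A w ^ i)" for w
  proof -
    have "(occ A w + 1) ^ m = (\<Sum>i<m. (m choose i) * occ A w ^ i) + occ A w ^ m"
      unfolding binomial_ring by (simp add: lessThan_Suc_atMost[symmetric])
    then have "occ A (w @ [a]) ^ m =
        occ A w ^ m + (if a \<in> A then \<Sum>i<m. (m choose i) * occ A w ^ i else 0)" for a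
      by (simp add: occ_def)
    then show ?thesis
      by (simp add: sum.distrib sum.If_cases)
  qed
  have "corr A B F (s + 1) m = (\<Sum>w\<in>?W s. \<Sum>a\<in>UNIV. occ A (w @ [a]) ^ m)"
    unfolding corr_eq_sum sum.reindex_bij_betw[OF bij, symmetric]
    by (simp add: sum.cartesian_product case_prod_unfold)
  also have "\<dots> = CARD('a) * corr A B F s m +
      card A * (\<Sum>i<m. (m choose i) * corr A B F s i)"
    unfolding step corr_eq_sum sum.distrib sum_distrib_left[symmetric]
    by (subst sum.swap) (simp add: sum_distrib_left)
  finally show ?thesis .
qed

lemma corr_ext_eq_corr:
  assumes "ca_radius_at_most s F"
  shows "corr_ext A B F s m = real (corr A B F s m)"
  using assms ca_radius_le_iff[OF assms] by (subst corr_ext.simps) simp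

lemma corr_ext_Suc:
  fixes A B :: "'a::finite set"
  assumes "ca_radius_at_most r F"
  shows "corr_ext A B F (s + 1) m = real CARD('a) * corr_ext A B F s m
           + real (card A) * (\<Sum>i<m. real (m choose i) * corr_ext A B F s i)"
proof (cases "ca_radius F \<le> s")
  case True
  then have *: "ca_radius_at_most s F" "ca_radius_at_most (s + 1) F"
    using ca_radius_le_iff[OF assms, of s] ca_radius_le_iff[OF assms, of "s + 1"] by simp_all
  show ?thesis
    unfolding corr_ext_eq_corr[OF *(1)] corr_ext_eq_corr[OF *(2)] corr_Suc[OF *(1)]
    by simp
next
  case False
  then show ?thesis
    by (simp add: corr_ext.simps[of A B F s m])
qed

lemma corr_ext_unique:
  fixes A B :: "'a::finite set"
  assumes "ca_radius_at_most r F"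
    and "\<And>s m. ca_radius_at_most s F \<Longrightarrow> c s m = real (corr A B F s m)"
    and "\<And>s m. c (s + 1) m = real CARD('a) * c s m
           + real (card A) * (\<Sum>i<m. real (m choose i) * c s i)"
  shows "c s m = corr_ext A B F s m"
  using assms
proof (induction A B F s m rule: corr_ext.induct)
  case (1 A B F s m)
  show ?case
  proof (cases "ca_radius F \<le> s")
    case True
    then have "ca_radius_at_most s F"
      using ca_radius_le_iff[OF "1.prems"(1)] by blast
    then show ?thesis
      using "1.prems"(2) corr_ext_eq_corr by metis
  next
    case False
    have "c (s + 1) m = corr_ext A B F (s + 1) m"
      using "1.IH"(1)[OF False] "1.prems" by blast
    moreover have "c s i = corr_ext A B F s i" if "i < m" for i
      using "1.IH"(2)[OF False _ "1.prems"] that by simp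
    ultimately have "real CARD('a) * c s m = corr_ext A B F (s + 1) m
        - real (card A) * (\<Sum>i<m. real (m choose i) * corr_ext A B F s i)"
      using "1.prems"(3)[of s m] by simp
    then show ?thesis
      using False by (simp add: corr_ext.simps[of A B F s m] eq_divide_eq mult.commute)
  qed
qed

end

theory Submission
  imports Defs
begin

text \<open>Give each letter the centred weight \<open>h a = |\<Sigma>| [a \<in> A] - |A|\<close>, and let \<open>C\<close> be the covariance of
  the weight of \<open>f v\<close> and the total weight of \<open>v\<close> for a random word \<open>v\<close> of length \<open>r + 1\<close>. Up to a
  positive factor and a summand depending only on \<open>|A|\<close>, \<open>|\<Sigma>|\<close> and \<open>r\<close>, this is the correlation
  of order 1. A surjective \<open>F\<close> is balanced: every word of length \<open>n\<close> has exactly \<open>|\<Sigma>|\<^sup>r\<close>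
  preimages of length \<open>n + r\<close>. So for a random word of length \<open>n + r\<close> the total weights of the
  word and of its image have variances \<open>(n + r) V\<close> and \<open>n V\<close>, where \<open>V\<close> is the variance of \<open>h\<close>,
  while their covariance is \<open>n C\<close>. As the variance of the difference is nonnegative,
  \<open>2 n C \<le> (2 n + r) V\<close>, and letting \<open>n\<close> grow gives \<open>C \<le> V\<close>. For the identity, \<open>C = V\<close>.\<close>

definition words :: "nat \<Rightarrow> 'a list set" where
  "words n = {w. length w = n}"

text \<open>The action of \<open>F\<close> on finite words, one image letter per window of
  \<open>r + 1\<close> letters. Truncated subtraction sends words of length at most \<open>r\<close>
  to \<open>[]\<close>.\<close>

definition block_map :: "nat \<Rightarrow> ('a list \<Rightarrow> 'b) \<Rightarrow> 'a list \<Rightarrow> 'b list" where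
  "block_map r f w = map (\<lambda>i. f (take (r + 1) (drop i w))) [0..<length w - r]"

text \<open>A sum of indicators rather than a cardinality, so that double counting becomes
  exchanging sums.\<close>

definition preimage_count :: "nat \<Rightarrow> ('a list \<Rightarrow> 'a) \<Rightarrow> 'a list \<Rightarrow> nat" where
  "preimage_count r f u = (\<Sum>w\<in>words (length u + r). of_bool (block_map r f w = u))"

definition weight :: "('a \<Rightarrow> int) \<Rightarrow> 'a list \<Rightarrow> int" where
  "weight h w = sum_list (map h w)"

subsection \<open>Sums over words\<close>

lemma finite_words_set [simp]: "finite (words n :: 'a::finite list set)"
  using finite_words[of n "\<lambda>_. True"] by (simp add: words_def)

lemma words_0 [simp]: "words 0 = {[]}"
  by (auto simp: words_def)

lemma card_words [simp]: "card (words n :: 'a::finite list set) = CARD('a) ^ n"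
  using card_lists_length_eq[of "UNIV :: 'a set" n] by (simp add: words_def)

lemma sum_words_append:
  "(\<Sum>w\<in>words (m + n). g w) = (\<Sum>u\<in>words m. \<Sum>v\<in>words n. g (u @ v))"
  for g :: "'a::finite list \<Rightarrow> 'b::comm_monoid_add"
proof -
  have "bij_betw (\<lambda>(u, v). u @ v) (words m \<times> words n) (words (m + n) :: 'a list set)"
    by (rule bij_betw_byWitness[where f' = "\<lambda>w. (take m w, drop m w)"])
      (auto simp: words_def)
  then show ?thesis
    by (simp add: sum.reindex_bij_betw[symmetric] sum.cartesian_product case_prod_unfold)
qed

lemma sum_words_1: "(\<Sum>w\<in>words (Suc 0). g w) = (\<Sum>a\<in>UNIV. g [a])"
  for g :: "'a::finite list \<Rightarrow> 'b::comm_monoid_add"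
proof -
  have "words (Suc 0) = (\<lambda>a. [a]) ` (UNIV :: 'a set)"
    by (auto simp: words_def length_Suc_conv)
  then show ?thesis
    by (simp add: sum.reindex inj_on_def)
qed

lemma sum_words_Suc:
  "(\<Sum>w\<in>words (Suc n). g w) = (\<Sum>a\<in>UNIV. \<Sum>w\<in>words n. g (a # w))"
  for g :: "'a::finite list \<Rightarrow> 'b::comm_monoid_add"
  using sum_words_append[of g "Suc 0" n] by (simp add: sum_words_1)

lemma sum_of_bool_eq_words:
  fixes z :: "'a::finite list"
  assumes "z \<in> words k"
  shows "(\<Sum>x\<in>words k. of_bool (P \<and> z = x)) = (of_bool P :: 'b::semiring_1)"
proof -
  have "(\<Sum>x\<in>words k. of_bool (P \<and> z = x)) = (\<Sum>x\<in>words k. if z = x then of_bool P else (0::'b))"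
    by (intro sum.cong) auto
  then show ?thesis
    using assms by simp
qed

subsection \<open>Balance of surjective cellular automata\<close>

lemma length_block_map [simp]: "length (block_map r f w) = length w - r"
  by (simp add: block_map_def)

lemma block_map_Cons:
  assumes "r \<le> length w"
  shows "block_map r f (a # w) = f (a # take r w) # block_map r f w"
  by (rule nth_equalityI) (use assms in \<open>auto simp: block_map_def nth_Cons split: nat.splits\<close>)

lemma take_block_map_append:
  assumes "length v = n + r"
  shows "take n (block_map r f (v @ w)) = block_map r f v"
  by (rule nth_equalityI) (use assms in \<open>auto simp: block_map_def\<close>)

lemma drop_block_map_append:
  "drop (length v) (block_map r f (v @ w)) = block_map r f w"
  by (rule nth_equalityI) (auto simp: block_map_def)

text \<open>Double counting: dropping the last \<open>k\<close> letters of a preimage of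
  \<open>u @ z\<close> leaves a preimage of \<open>u\<close>, and each prolongation of the latter by
  \<open>k\<close> letters determines \<open>z\<close>.\<close>

lemma sum_preimage_count_extend:
  fixes f :: "'a::finite list \<Rightarrow> 'a"
  shows "(\<Sum>z\<in>words k. preimage_count r f (u @ z)) = CARD('a) ^ k * preimage_count r f u"
proof -
  let ?n = "length u" and ?g = "block_map r f"
  have eq: "?g (v @ s) = u @ z \<longleftrightarrow> ?g v = u \<and> drop ?n (?g (v @ s)) = z"
    if "v \<in> words (?n + r)" for v s z
  proof -
    have "take ?n (?g (v @ s)) = ?g v"
      using that by (intro take_block_map_append) (simp add: words_def)
    then show ?thesis
      unfolding eq_commute[of "?g (v @ s)" "u @ z"] append_eq_conv_conj by metis
  qed
  have "(\<Sum>z\<in>words k. preimage_count r f (u @ z)) =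
      (\<Sum>z\<in>words k. \<Sum>v\<in>words (?n + r). \<Sum>s\<in>words k. of_bool (?g (v @ s) = u @ z))"
  proof (rule sum.cong[OF refl])
    fix z :: "'a list" assume "z \<in> words k"
    then have "length (u @ z) + r = (?n + r) + k"
      by (simp add: words_def)
    then show "preimage_count r f (u @ z) =
        (\<Sum>v\<in>words (?n + r). \<Sum>s\<in>words k. of_bool (?g (v @ s) = u @ z))"
      unfolding preimage_count_def by (simp only: sum_words_append)
  qed
  also have "\<dots> = (\<Sum>v\<in>words (?n + r). \<Sum>s\<in>words k. \<Sum>z\<in>words k. of_bool (?g (v @ s) = u @ z))"
    by (subst sum.swap) (intro sum.cong refl sum.swap)
  also have "\<dots> = (\<Sum>v\<in>words (?n + r). \<Sum>s\<in>(words k :: 'a list set). of_bool (?g v = u))"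
  proof (intro sum.cong refl)
    fix v s :: "'a list" assume "v \<in> words (?n + r)" "s \<in> words k"
    then show "(\<Sum>z\<in>words k. of_bool (?g (v @ s) = u @ z)) = (of_bool (?g v = u) :: nat)"
      unfolding eq[OF \<open>v \<in> words (?n + r)\<close>] by (intro sum_of_bool_eq_words) (auto simp: words_def)
  qed
  finally show ?thesis
    by (simp add: preimage_count_def sum_distrib_left)
qed

text \<open>Any two preimages of \<open>u\<close> concatenate to a preimage of \<open>u z u\<close> for a unique \<open>z\<close>.\<close>

lemma sum_preimage_count_gap:
  fixes f :: "'a::finite list \<Rightarrow> 'a"
  shows "(\<Sum>z\<in>words r. preimage_count r f (u @ z @ u)) = preimage_count r f u ^ 2"
proof -
  let ?n = "length u" and ?g = "block_map r f"
  have eq: "?g (v @ s) = u @ z @ u \<longleftrightarrow> (?g v = u \<and> ?g s = u) \<and> take r (drop ?n (?g (v @ s))) = z"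
    if "v \<in> words (?n + r)" "s \<in> words (?n + r)" "z \<in> words r" for v s z
  proof -
    have "?g (v @ s) = u @ z @ u \<longleftrightarrow> take ?n (?g (v @ s)) = u \<and>
        take r (drop ?n (?g (v @ s))) = z \<and> drop (?n + r) (?g (v @ s)) = u"
      unfolding eq_commute[of "?g (v @ s)" "u @ z @ u"] using that
      by (auto simp: words_def append_eq_conv_conj add.commute)
    then show ?thesis
      using take_block_map_append[of v ?n r f s] drop_block_map_append[of v r f s] that
      by (auto simp: words_def)
  qed
  have "(\<Sum>z\<in>words r. preimage_count r f (u @ z @ u)) =
      (\<Sum>z\<in>words r. \<Sum>v\<in>words (?n + r). \<Sum>s\<in>words (?n + r). of_bool (?g (v @ s) = u @ z @ u))"
  proof (rule sum.cong[OF refl])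
    fix z :: "'a list" assume "z \<in> words r"
    then have "length (u @ z @ u) + r = (?n + r) + (?n + r)"
      by (simp add: words_def)
    then show "preimage_count r f (u @ z @ u) =
        (\<Sum>v\<in>words (?n + r). \<Sum>s\<in>words (?n + r). of_bool (?g (v @ s) = u @ z @ u))"
      unfolding preimage_count_def by (simp only: sum_words_append)
  qed
  also have "\<dots> = (\<Sum>v\<in>words (?n + r). \<Sum>s\<in>words (?n + r). \<Sum>z\<in>words r. of_bool (?g (v @ s) = u @ z @ u))"
    by (subst sum.swap) (intro sum.cong refl sum.swap)
  also have "\<dots> = (\<Sum>v\<in>words (?n + r). \<Sum>s\<in>words (?n + r). of_bool (?g v = u \<and> ?g s = u))"
  proof (intro sum.cong refl)
    fix v s :: "'a list" assume vs: "v \<in> words (?n + r)" "s \<in> words (?n + r)"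
    have "(\<Sum>z\<in>words r. of_bool (?g (v @ s) = u @ z @ u)) =
        (\<Sum>z\<in>words r. of_bool ((?g v = u \<and> ?g s = u) \<and> take r (drop ?n (?g (v @ s))) = z) :: nat)"
      using vs by (intro sum.cong refl) (simp add: eq)
    also have "\<dots> = of_bool (?g v = u \<and> ?g s = u)"
      using vs by (intro sum_of_bool_eq_words) (auto simp: words_def)
    finally show "(\<Sum>z\<in>words r. of_bool (?g (v @ s) = u @ z @ u)) =
        (of_bool (?g v = u \<and> ?g s = u) :: nat)" .
  qed
  finally show ?thesis
    unfolding preimage_count_def power2_eq_square sum_product of_bool_conj .
qed

lemma sum_preimage_count:
  fixes f :: "'a::finite list \<Rightarrow> 'a"
  shows "(\<Sum>u\<in>words n. preimage_count r f u) = CARD('a) ^ (n + r)"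
  \<comment> \<open>All words of length \<open>r\<close> are preimages of the empty word.\<close>
  using sum_preimage_count_extend[of r f "[]" n]
  by (simp add: preimage_count_def block_map_def words_def[of r] power_add
      card_words[unfolded words_def])

text \<open>If \<open>u\<close> has the least number \<open>m\<close> of preimages, so has every extension of \<open>u\<close> on the right,
  since the average over the extensions is \<open>m\<close>; counting the preimages of all words \<open>u z u\<close>
  with \<open>|z| = r\<close> then gives \<open>m\<^sup>2 = |\<Sigma>|\<^sup>r m\<close>. So the average number of preimages equals the minimum.\<close>

lemma preimage_count_eq:
  fixes f :: "'a::finite list \<Rightarrow> 'a"
  assumes surj: "\<And>u. \<exists>w\<in>words (length u + r). block_map r f w = u"
  shows "preimage_count r f u = CARD('a) ^ r"
proof -
  let ?N = "preimage_count r f"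
  obtain u0 where min: "\<And>v. ?N u0 \<le> ?N v"
    using ex_has_least_nat[of "\<lambda>_. True" _ ?N] by auto
  \<comment> \<open>Surjectivity gives positivity, so that \<open>?N u0\<close> can be cancelled in
    the quadratic identity below.\<close>
  have "?N u0 > 0"
  proof -
    obtain w where "w \<in> words (length u0 + r)" "block_map r f w = u0"
      using surj by blast
    then show ?thesis
      unfolding preimage_count_def by (intro sum_pos2[of _ w]) auto
  qed
  have ext: "?N (u0 @ z) = ?N u0" for z
  proof -
    have "(\<Sum>z\<in>(words (length z) :: 'a list set). ?N u0) = (\<Sum>z\<in>words (length z). ?N (u0 @ z))"
      by (simp add: sum_preimage_count_extend)
    moreover have "z \<in> words (length z)"
      by (simp add: words_def)
    ultimately show ?thesis
      using sum_mono_inv[of "\<lambda>_. ?N u0" "words (length z)" "\<lambda>z. ?N (u0 @ z)" z] min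
      by simp
  qed
  have "?N u0 ^ 2 = CARD('a) ^ r * ?N u0"
    using sum_preimage_count_gap[of r f u0] by (simp add: ext)
  then have "?N u0 = CARD('a) ^ r"
    using \<open>?N u0 > 0\<close> by (simp add: power2_eq_square)
  then have le: "CARD('a) ^ r \<le> ?N v" for v
    using min[of v] by simp
  have "(\<Sum>v\<in>(words (length u) :: 'a list set). CARD('a) ^ r) = (\<Sum>v\<in>words (length u). ?N v)"
    by (simp add: sum_preimage_count power_add)
  moreover have "u \<in> words (length u)"
    by (simp add: words_def)
  ultimately show ?thesis
    using sum_mono_inv[of "\<lambda>_. CARD('a) ^ r" "words (length u)" ?N u] le
    by simp
qed

text \<open>Group the words by their image: by balance all classes have the same size, so images of
  uniform words are uniform.\<close>

lemma sum_block_map: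
  fixes f :: "'a::finite list \<Rightarrow> 'a" and g :: "'a list \<Rightarrow> int"
  assumes surj: "\<And>u. \<exists>w\<in>words (length u + r). block_map r f w = u"
  shows "(\<Sum>w\<in>words (n + r). g (block_map r f w)) = CARD('a) ^ r * (\<Sum>u\<in>words n. g u)"
proof -
  have "(\<Sum>w\<in>words (n + r). g (block_map r f w)) =
      (\<Sum>w\<in>words (n + r). \<Sum>u\<in>words n. g u * of_bool (block_map r f w = u))"
    by (intro sum.cong refl) (simp add: words_def of_bool_def if_distrib finite_words_set[unfolded words_def] cong: if_cong)
  also have "\<dots> = (\<Sum>u\<in>words n. g u * int (\<Sum>w\<in>words (length u + r). of_bool (block_map r f w = u)))"
    by (subst sum.swap) (auto intro!: sum.cong simp: sum_distrib_left words_def)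
  also have "\<dots> = (\<Sum>u\<in>words n. g u * int (CARD('a) ^ r))"
    unfolding preimage_count_def[symmetric] preimage_count_eq[OF surj] ..
  finally show ?thesis
    by (simp add: mult.commute flip: sum_distrib_right)
qed

lemma block_map_local_rule:
  assumes "is_local_rule r f F" "surj F"
  shows "\<exists>w\<in>words (length u + r). block_map r f w = u"
proof -
  \<comment> \<open>Only the coordinates from 0 to \<open>length u - 1\<close> matter; negative ones
    get \<open>u ! 0\<close>, those past the word an unspecified value.\<close>
  obtain x where x: "F x = (\<lambda>i. u ! nat i)"
    using assms(2) by (metis surjD)
  define w where "w = map (\<lambda>i. x (int i)) [0..<length u + r]"
  have "f (take (r + 1) (drop i w)) = u ! i" if "i < length u" for i
  proof -
    have "take (r + 1) (drop i w) = map x [int i..int i + int r]"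
      by (rule nth_equalityI) (use that in \<open>auto simp: w_def\<close>)
    then show ?thesis
      using assms(1) x unfolding is_local_rule_def by (metis nat_int)
  qed
  then have "block_map r f w = u"
    by (intro nth_equalityI) (auto simp: block_map_def w_def)
  moreover have "w \<in> words (length u + r)"
    by (simp add: words_def w_def)
  ultimately show ?thesis
    by blast
qed

subsection \<open>Second moments of centred weights\<close>

lemma weight_simps [simp]:
  "weight h [] = 0" "weight h (a # w) = h a + weight h w"
  "weight h (v @ w) = weight h v + weight h w"
  by (simp_all add: weight_def)

lemma sum_weight:
  fixes h :: "'a::finite \<Rightarrow> int"
  assumes "(\<Sum>a\<in>UNIV. h a) = 0"
  shows "(\<Sum>w\<in>words n. weight h w) = 0"
proof (induction n)
  case (Suc n)
  then show ?case
    using assms by (simp add: sum_words_Suc sum.distrib flip: sum_distrib_left)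
qed simp

text \<open>Variances of independent letters add, as the cross terms vanish for centred
  \<open>h\<close>. The factor \<open>CARD('a)\<close> on the left avoids the exponent
  \<open>n - 1\<close>.\<close>

lemma sum_weight_square:
  fixes h :: "'a::finite \<Rightarrow> int"
  assumes "(\<Sum>a\<in>UNIV. h a) = 0"
  shows "CARD('a) * (\<Sum>w\<in>words n. (weight h w)\<^sup>2) = n * CARD('a) ^ n * (\<Sum>a\<in>UNIV. (h a)\<^sup>2)"
proof (induction n)
  case (Suc n)
  have "(\<Sum>w\<in>words (Suc n). (weight h w)\<^sup>2) =
      CARD('a) ^ n * (\<Sum>a\<in>UNIV. (h a)\<^sup>2) + CARD('a) * (\<Sum>w\<in>words n. (weight h w)\<^sup>2)"
    using sum_weight[OF assms, of n]
    by (simp add: sum_words_Suc power2_sum sum.distrib flip: sum_distrib_left sum_distrib_right)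
  then show ?case
    using Suc by (simp add: algebra_simps)
qed simp

text \<open>Each image letter is uncorrelated with the letters outside its window, so all
  \<open>n\<close> contribute the same covariance; the induction splits off the first.\<close>

lemma sum_weight_block_map:
  fixes h :: "'a::finite \<Rightarrow> int" and f :: "'a list \<Rightarrow> 'a"
  assumes "(\<Sum>a\<in>UNIV. h a) = 0"
  shows "CARD('a) * (\<Sum>w\<in>words (n + r). weight h (block_map r f w) * weight h w) =
    n * CARD('a) ^ n * (\<Sum>v\<in>words (r + 1). h (f v) * weight h v)"
proof (induction n)
  case 0
  have "block_map r f w = []" if "w \<in> words r" for w
    using that by (simp add: block_map_def words_def)
  then show ?case by simp
next
  case (Suc n)
  let ?g = "block_map r f" and ?C = "\<Sum>v\<in>words (r + 1). h (f v) * weight h v"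
  have "(\<Sum>w\<in>words (Suc n + r). weight h (?g w) * weight h w) =
     (\<Sum>w\<in>words (Suc n + r). h (f (take (r + 1) w)) * weight h w + weight h (?g (tl w)) * weight h w)"
  proof (rule sum.cong[OF refl])
    fix w :: "'a list" assume "w \<in> words (Suc n + r)"
    then obtain a w' where w: "w = a # w'" "length w' = n + r"
      by (auto simp: words_def length_Suc_conv)
    then show "weight h (?g w) * weight h w =
        h (f (take (r + 1) w)) * weight h w + weight h (?g (tl w)) * weight h w"
      by (simp add: block_map_Cons algebra_simps)
  qed
  also have "\<dots> = (\<Sum>w\<in>words ((r + 1) + n). h (f (take (r + 1) w)) * weight h w) +
      (\<Sum>w\<in>words (Suc (n + r)). weight h (?g (tl w)) * weight h w)"
    by (simp add: sum.distrib ac_simps)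
  also have "(\<Sum>w\<in>words ((r + 1) + n). h (f (take (r + 1) w)) * weight h w) =
      (\<Sum>v\<in>words (r + 1). \<Sum>w\<in>words n. h (f v) * weight h v + h (f v) * weight h w)"
    unfolding sum_words_append by (intro sum.cong refl) (auto simp: words_def algebra_simps)
  \<comment> \<open>The letters after the first window average to weight 0.\<close>
  also have "\<dots> = CARD('a) ^ n * ?C"
    using sum_weight[OF assms, of n]
    by (simp add: sum.distrib flip: sum_distrib_left)
  \<comment> \<open>The first letter of \<open>w\<close> does not enter \<open>?g (tl w)\<close>, so
    its weight sums to 0.\<close>
  also have "(\<Sum>w\<in>words (Suc (n + r)). weight h (?g (tl w)) * weight h w) =
      CARD('a) * (\<Sum>w\<in>words (n + r). weight h (?g w) * weight h w)"
    using assms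
    by (simp add: sum_words_Suc algebra_simps sum.distrib flip: sum_distrib_left sum_distrib_right)
  finally show ?case
    using Suc by (simp add: algebra_simps)
qed

lemma correlation_le:
  fixes h :: "'a::finite \<Rightarrow> int" and f :: "'a list \<Rightarrow> 'a"
  assumes h: "(\<Sum>a\<in>UNIV. h a) = 0"
    and surj: "\<And>u. \<exists>w\<in>words (length u + r). block_map r f w = u"
  shows "(\<Sum>v\<in>words (r + 1). h (f v) * weight h v) \<le> CARD('a) ^ r * (\<Sum>a\<in>UNIV. (h a)\<^sup>2)"
    (is "?C \<le> ?Q * ?V")
proof -
  let ?q = "int CARD('a)" and ?g = "block_map r f"
  have bound: "2 * int n * ?C \<le> (2 * int n + int r) * (?Q * ?V)" for n
  proof -
    have "0 \<le> ?q * (\<Sum>w\<in>words (n + r). (weight h (?g w) - weight h w)\<^sup>2)"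
      by (simp add: sum_nonneg)
    also have "\<dots> = ?Q * (?q * (\<Sum>w\<in>words n. (weight h w)\<^sup>2)) +
        ?q * (\<Sum>w\<in>words (n + r). (weight h w)\<^sup>2) -
        2 * (?q * (\<Sum>w\<in>words (n + r). weight h (?g w) * weight h w))"
      using sum_block_map[OF surj, of "\<lambda>w. (weight h w)\<^sup>2" n]
      by (simp add: power2_diff sum.distrib sum_subtractf sum_distrib_left algebra_simps)
    also have "\<dots> = ?q ^ n * ((2 * int n + int r) * (?Q * ?V) - 2 * int n * ?C)"
      unfolding sum_weight_square[OF h] sum_weight_block_map[OF h]
      by (simp add: algebra_simps power_add)
    finally have "?q ^ n * 0 \<le> ?q ^ n * ((2 * int n + int r) * (?Q * ?V) - 2 * int n * ?C)"
      by (simp only: mult_zero_right)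
    moreover have "0 < ?q ^ n" by simp
    ultimately show ?thesis
      by (simp only: mult_le_cancel_left_pos diff_ge_0_iff_ge)
  qed
  show ?thesis
  proof (rule ccontr)
    assume "\<not> ?thesis"
    \<comment> \<open>Integrality gives a gap of 1, so an explicit \<open>n\<close> replaces the
      limit.\<close>
    then have *: "?C \<ge> ?Q * ?V + 1" by simp
    have V: "?Q * ?V \<ge> 0" by (simp add: sum_nonneg)
    \<comment> \<open>With the gap, \<open>bound\<close> would force
      \<open>2 * n \<le> r * (?Q * ?V)\<close>, which this \<open>n\<close> violates.\<close>
    define n where "n = nat (int r * (?Q * ?V)) + 1"
    have "int n = int r * (?Q * ?V) + 1"
      using V by (simp add: n_def)
    moreover have "2 * int n * (?Q * ?V + 1) \<le> 2 * int n * ?C"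
      using * by (intro mult_left_mono) auto
    ultimately show False
      using bound[of n] V by (simp add: algebra_simps)
  qed
qed

subsection \<open>Correlations as covariances\<close>

text \<open>The indicator of \<open>A\<close> minus its mean, scaled by \<open>CARD('a)\<close> to
  stay integral.\<close>

definition centred :: "'a::finite set \<Rightarrow> 'a \<Rightarrow> int" where
  "centred A a = int CARD('a) * of_bool (a \<in> A) - int (card A)"

lemma sum_centred: "(\<Sum>a\<in>UNIV. centred A a) = 0"
  by (simp add: centred_def sum_subtractf of_bool_def sum.If_cases flip: sum_distrib_left)

lemma weight_centred:
  "weight (centred A) w = int CARD('a) * int (occ A w) - int (card A) * int (length w)" for w :: "'a::finite list"
  by (induction w) (auto simp: centred_def occ_def algebra_simps)

text \<open>Balance for one-letter words: each letter of \<open>A\<close> has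
  \<open>CARD('a) ^ r\<close> preimages.\<close>

lemma corr_0:
  fixes A :: "'a::finite set"
  assumes rule: "is_local_rule r f F" and "surj F"
  shows "corr A A F r 0 = CARD('a) ^ r * card A"
proof -
  have "int (corr A A F r 0) = (\<Sum>w\<in>words (r + 1). of_bool (f w \<in> A))"
    using local_rule_eqI[OF rule]
    by (auto simp: corr_eq_sum of_bool_def words_def finite_words_set[unfolded words_def]
        finite_words sum.If_cases intro!: arg_cong[of _ _ card])
  also have "\<dots> = (\<Sum>w\<in>words (1 + r). of_bool (block_map r f w ! 0 \<in> A))"
    by (intro sum.cong) (auto simp: block_map_def words_def)
  also have "\<dots> = int (CARD('a) ^ r) * (\<Sum>u\<in>words 1. of_bool (u ! 0 \<in> A))"
    using sum_block_map[OF block_map_local_rule[OF assms], of "\<lambda>u. of_bool (u ! 0 \<in> A)" 1] .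
  also have "\<dots> = int (CARD('a) ^ r * card A)"
    by (simp add: sum_words_1 of_bool_def sum.If_cases)
  finally show ?thesis
    by linarith
qed

text \<open>Centring the image letter costs nothing, since the total weights sum to 0; the remaining
  order 0 term is the same for all surjective \<open>F\<close> by \<open>corr_0\<close>.\<close>

lemma covariance_eq_corr:
  fixes A :: "'a::finite set"
  assumes rule: "is_local_rule r f F" and "surj F"
  shows "(\<Sum>v\<in>words (r + 1). centred A (f v) * weight (centred A) v) =
    int CARD('a) ^ 2 * corr A A F r 1 - int CARD('a) ^ (r + 1) * int (card A) ^ 2 * (r + 1)"
proof -
  let ?q = "int CARD('a)" and ?a = "int (card A)" and ?W = "words (r + 1) :: 'a list set"
  have corr: "int (corr A A F r m) = (\<Sum>v\<in>?W. of_bool (f v \<in> A) * int (occ A v) ^ m)" for m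
  proof -
    have "{w. length w = r + 1 \<and> local_rule r F w \<in> A} = {w \<in> ?W. f w \<in> A}"
      using local_rule_eqI[OF rule] by (auto simp: words_def)
    then show ?thesis
      by (simp add: corr_eq_sum of_bool_def if_distrib[of "\<lambda>x. x * _"] sum.If_cases Int_def cong: if_cong)
  qed
  have "(\<Sum>v\<in>?W. centred A (f v) * weight (centred A) v) =
      (\<Sum>v\<in>?W. ?q * (of_bool (f v \<in> A) * weight (centred A) v)) -
      ?a * (\<Sum>v\<in>?W. weight (centred A) v)"
    unfolding sum_distrib_left sum_subtractf[symmetric]
    by (intro sum.cong refl) (simp add: centred_def algebra_simps)
  also have "\<dots> = (\<Sum>v\<in>?W. ?q ^ 2 * (of_bool (f v \<in> A) * int (occ A v) ^ 1) -
      ?q * ?a * (r + 1) * (of_bool (f v \<in> A) * int (occ A v) ^ 0))"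
    unfolding sum_weight[OF sum_centred]
    by (simp, intro sum.cong refl)
      (simp add: weight_centred words_def algebra_simps power2_eq_square)
  also have "\<dots> = ?q ^ 2 * corr A A F r 1 - ?q * ?a * (r + 1) * corr A A F r 0"
    unfolding sum_subtractf sum_distrib_left[symmetric] corr ..
  finally show ?thesis
    by (simp add: corr_0[OF assms] algebra_simps power2_eq_square)
qed

text \<open>The later letters are independent of the first, leaving the variance of one
  letter.\<close>

lemma covariance_id:
  fixes h :: "'a::finite \<Rightarrow> int"
  assumes "(\<Sum>a\<in>UNIV. h a) = 0"
  shows "(\<Sum>v\<in>words (r + 1). h (hd v) * weight h v) = CARD('a) ^ r * (\<Sum>a\<in>UNIV. (h a)\<^sup>2)"
  using sum_weight[OF assms, of r]
  by (simp add: sum_words_Suc distrib_left sum.distrib power2_eq_square flip: sum_distrib_left)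

lemma corr_le_corr_id:
  fixes A :: "'a::finite set"
  assumes "is_local_rule r f F" "surj F"
  shows "corr A A F r 1 \<le> corr A A id r 1"
proof -
  have "(\<Sum>v\<in>words (r + 1). centred A (f v) * weight (centred A) v) \<le>
      (\<Sum>v\<in>words (r + 1). centred A (hd v) * weight (centred A) v)"
    unfolding covariance_id[OF sum_centred]
    using correlation_le[OF sum_centred block_map_local_rule[OF assms]] .
  then show ?thesis
    unfolding covariance_eq_corr[OF assms] covariance_eq_corr[OF is_local_rule_id surj_id]
    by simp
qed

subsection \<open>Normalized correlations\<close>

lemma corr_ext_order_0:
  fixes A B :: "'a::finite set"
  assumes "ca_radius_at_most r F"
  shows "corr_ext A B F s 0 = CARD('a) ^ s * corr_ext A B F 0 0"
  using corr_ext_Suc[OF assms, of A B _ 0] by (induction s) simp_all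

text \<open>The recursion unrolled down to level 0; the factor \<open>CARD('a)\<close> avoids the
  exponent \<open>s - 1\<close>.\<close>

lemma corr_ext_order_1:
  fixes A B :: "'a::finite set"
  assumes "ca_radius_at_most r F"
  shows "CARD('a) * corr_ext A B F s 1 =
    CARD('a) ^ (s + 1) * corr_ext A B F 0 1 + s * CARD('a) ^ s * card A * corr_ext A B F 0 0"
proof (induction s)
  case (Suc s)
  then show ?case
    using corr_ext_Suc[OF assms, of A B s 1] corr_ext_order_0[OF assms, of A B s]
    by (simp add: algebra_simps)
qed simp

text \<open>With equal order 0 terms, both order 1 values at level \<open>r\<close> arise from those
  at level 0 by the same increasing affine map.\<close>

lemma norm_corr_le:
  fixes A :: "'a::finite set"
  assumes F: "ca_radius_at_most r F" and G: "ca_radius_at_most r G"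
    and "corr A B F r 0 = corr A B G r 0" "corr A B F r 1 \<le> corr A B G r 1"
  shows "norm_corr A B F 1 \<le> norm_corr A B G 1"
proof -
  have 0: "corr_ext A B F 0 0 = corr_ext A B G 0 0"
    using assms(3) corr_ext_order_0[OF F, of A B r] corr_ext_order_0[OF G, of A B r]
    by (simp add: corr_ext_eq_corr[OF F] corr_ext_eq_corr[OF G])
  have "real CARD('a) * corr_ext A B F r 1 \<le> real CARD('a) * corr_ext A B G r 1"
    using assms(4) by (simp add: corr_ext_eq_corr[OF F] corr_ext_eq_corr[OF G])
  then have "real CARD('a) ^ (r + 1) * corr_ext A B F 0 1 \<le> real CARD('a) ^ (r + 1) * corr_ext A B G 0 1"
    unfolding corr_ext_order_1[OF F] corr_ext_order_1[OF G] 0 by simp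
  then show ?thesis
    unfolding norm_corr_def by (rule mult_left_le_imp_le) simp
qed

lemma ca_radius_at_most_id: "ca_radius_at_most r id"
  using is_local_rule_id ca_radius_at_most_iff by blast

text \<open>As \<open>id\<close> has radius 0, level 0 is an ordinary correlation over one-letter
  words.\<close>

lemma norm_corr_id: "norm_corr A A id 1 = real (card A)" for A :: "'a::finite set"
proof -
  have "{w. length w = 1 \<and> local_rule 0 id w \<in> A} = (\<lambda>a. [a]) ` A"
  proof -
    have "local_rule 0 id [a] = a" for a :: 'a
      using local_rule_eqI[OF is_local_rule_id[of 0], of "[a]"] by simp
    then show ?thesis
      by (auto simp: length_Suc_conv)
  qed
  then show ?thesis
    by (simp add: norm_corr_def corr_ext_eq_corr[OF ca_radius_at_most_id] corr_eq_sum
        sum.reindex inj_on_def occ_def)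
qed

theorem theorem4:
  fixes F :: "(int \<Rightarrow> 'a::finite) \<Rightarrow> (int \<Rightarrow> 'a)" and A :: "'a set" and r :: nat
  assumes "ca_radius_at_most r F" and "surj F"
  shows "corr A A F r 1 \<le> corr A A id r 1
       \<and> norm_corr A A F 1 \<le> norm_corr A A id 1
       \<and> norm_corr A A id 1 = real (card A)"
proof -
  obtain f where f: "is_local_rule r f F"
    using assms(1) ca_radius_at_most_iff by blast
  have "corr A A F r 0 = corr A A id r 0"
    by (simp add: corr_0[OF f assms(2)] corr_0[OF is_local_rule_id surj_id])
  then show ?thesis
    using corr_le_corr_id[OF f assms(2)] norm_corr_le[OF assms(1) ca_radius_at_most_id]
      norm_corr_id by blast
qed

end
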